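(* Let $R$ be a commutative ring with nonzero identity. Then $GD(R)$ is a Noetherian space if and only if $\mathcal R_{\mathrm{pr}}(R)=\{\sqrt{aR}:a\in R^\#\}$, ordered by inclusion, is well-quasi-ordered.
   Context: For a commutative ring $R$ with nonzero identity and unit group $U(R)$, let $R^\#=R\setminus(U(R)\cup\{0\})$ be the set of nonzero nonunits. For $a,b\in R^\#$ write $a\sim b$ if $aR=bR$; $[a]$ denotes the equivalence class of $a$ and $EC(R^\#)$ the set of equivalence classes. For $a\in R^\#$ put $B_a=\{[b]\in EC(R^\#): b\mid a^n\text{ for some }n\geq 1\}$. The sets $B_a$ ($a\in R^\#$) form a basis of a topology on $EC(R^\#)$; the resulting space is denoted $GD(R)$ (the generalized divisor topology). A topological space is Noetherian if its open sets satisfy the ascending chain condition. A quasi-ordered set $(Q,\leq)$ is well-quasi-ordered if every infinite sequence $q_1,q_2,\ldots$ in $Q$ contains indices $i<j$ with $q_i\leq q_j$. *)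

theory Defs
  imports "HOL-Algebra.Ideal" "HOL-Algebra.Divisibility" "HOL-Analysis.Abstract_Topology"
begin

definition nonzero_nonunits :: "('a, 'b) ring_scheme \<Rightarrow> 'a set" where
  "nonzero_nonunits R = carrier R - (Units R \<union> {\<zero>\<^bsub>R\<^esub>})"

definition pideal_rel :: "('a, 'b) ring_scheme \<Rightarrow> ('a \<times> 'a) set" where
  "pideal_rel R = {(a, b). a \<in> nonzero_nonunits R \<and> b \<in> nonzero_nonunits R \<and>
      PIdl\<^bsub>R\<^esub> a = PIdl\<^bsub>R\<^esub> b}"

definition pideal_class :: "('a, 'b) ring_scheme \<Rightarrow> 'a \<Rightarrow> 'a set" where
  "pideal_class R a = pideal_rel R `` {a}"

definition EC :: "('a, 'b) ring_scheme \<Rightarrow> 'a set set" where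
  "EC R = nonzero_nonunits R // pideal_rel R"

definition GD_basic :: "('a, 'b) ring_scheme \<Rightarrow> 'a \<Rightarrow> 'a set set" where
  "GD_basic R a = {pideal_class R b | b. b \<in> nonzero_nonunits R \<and>
      (\<exists>n::nat. n \<ge> 1 \<and> b divides\<^bsub>R\<^esub> (a [^]\<^bsub>R\<^esub> n))}"

(* The open sets are the arbitrary unions of basic sets.  The function topology returns a
   meaningful value only for families that satisfy the axioms of a topology; this holds
   for every commutative ring by istopology_GD below. *)
definition GD :: "('a, 'b) ring_scheme \<Rightarrow> 'a set topology" where
  "GD R = topology (arbitrary union_of (\<lambda>U. \<exists>a \<in> nonzero_nonunits R. U = GD_basic R a))"

definition noetherian_space :: "'a topology \<Rightarrow> bool" where
  "noetherian_space X \<longleftrightarrow>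
    (\<forall>U :: nat \<Rightarrow> 'a set. (\<forall>n. openin X (U n)) \<and> (\<forall>n. U n \<subseteq> U (Suc n)) \<longrightarrow>
      (\<exists>m. \<forall>n\<ge>m. U n = U m))"

definition radical :: "('a, 'b) ring_scheme \<Rightarrow> 'a set \<Rightarrow> 'a set" where
  "radical R I = {x \<in> carrier R. \<exists>n::nat. n \<ge> 1 \<and> x [^]\<^bsub>R\<^esub> n \<in> I}"

definition principal_radicals :: "('a, 'b) ring_scheme \<Rightarrow> 'a set set" where
  "principal_radicals R = {radical R (PIdl\<^bsub>R\<^esub> a) | a. a \<in> nonzero_nonunits R}"

definition well_quasi_ordered_on :: "'a set \<Rightarrow> ('a \<Rightarrow> 'a \<Rightarrow> bool) \<Rightarrow> bool" where
  "well_quasi_ordered_on Q leq \<longleftrightarrow>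
    reflp_on Q leq \<and> transp_on Q leq \<and>
    (\<forall>q :: nat \<Rightarrow> 'a. (\<forall>i. q i \<in> Q) \<longrightarrow> (\<exists>i j. i < j \<and> leq (q i) (q j)))"

lemma equiv_pideal_rel: "equiv (nonzero_nonunits R) (pideal_rel R)"
  by (auto simp: equiv_def refl_on_def sym_def trans_def pideal_rel_def)

lemma pideal_class_eq_iff:
  assumes "a \<in> nonzero_nonunits R" "b \<in> nonzero_nonunits R"
  shows "pideal_class R a = pideal_class R b \<longleftrightarrow> PIdl\<^bsub>R\<^esub> a = PIdl\<^bsub>R\<^esub> b"
  using assms by (auto simp: pideal_class_def pideal_rel_def)

lemma EC_eq: "EC R = {pideal_class R b | b. b \<in> nonzero_nonunits R}"
  by (auto simp: EC_def quotient_def pideal_class_def)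

context cring
begin

lemma divides_iff_PIdl_subset:
  assumes "b \<in> carrier R" "x \<in> carrier R"
  shows "b divides x \<longleftrightarrow> x \<in> PIdl b"
  using assms by (auto simp: factor_def cgenideal_def m_comm)

lemma pideal_class_in_GD_basic_iff:
  assumes "a \<in> nonzero_nonunits R" "b \<in> nonzero_nonunits R"
  shows "pideal_class R b \<in> GD_basic R a \<longleftrightarrow> (\<exists>n::nat. n \<ge> 1 \<and> b divides (a [^] n))"
proof
  assume "pideal_class R b \<in> GD_basic R a"
  then obtain c and n :: nat where c: "pideal_class R b = pideal_class R c"
    "c \<in> nonzero_nonunits R" "n \<ge> 1" "c divides (a [^] n)"
    by (auto simp: GD_basic_def)
  moreover have "a \<in> carrier R" "b \<in> carrier R" "c \<in> carrier R"
    using assms c(2) by (auto simp: nonzero_nonunits_def)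
  moreover have "PIdl b = PIdl c"
    using c assms pideal_class_eq_iff by metis
  ultimately have "b divides (a [^] n)"
    by (simp add: divides_iff_PIdl_subset)
  with c(3) show "\<exists>n::nat. n \<ge> 1 \<and> b divides (a [^] n)" by blast
qed (use assms in \<open>auto simp: GD_basic_def\<close>)

lemma divides_pow:
  assumes "b \<in> carrier R" "a \<in> carrier R" "b divides a"
  shows "(b [^] (n::nat)) divides (a [^] n)"
proof -
  from assms obtain c where "c \<in> carrier R" "a = b \<otimes> c" by (auto simp: factor_def)
  then show ?thesis using assms(1) by (auto simp: factor_def nat_pow_distrib)
qed

lemma GD_basic_mono:
  assumes a: "a \<in> nonzero_nonunits R" and c: "c \<in> nonzero_nonunits R"
    and ca: "pideal_class R c \<in> GD_basic R a"
  shows "GD_basic R c \<subseteq> GD_basic R a"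
proof
  have car: "a \<in> carrier R" "c \<in> carrier R"
    using a c by (auto simp: nonzero_nonunits_def)
  obtain n :: nat where n: "n \<ge> 1" "c divides (a [^] n)"
    using ca pideal_class_in_GD_basic_iff[OF a c] by blast
  fix U assume "U \<in> GD_basic R c"
  then obtain d and m :: nat where d: "U = pideal_class R d" "d \<in> nonzero_nonunits R"
    "m \<ge> 1" "d divides (c [^] m)" by (auto simp: GD_basic_def)
  have dcar: "d \<in> carrier R" using d by (auto simp: nonzero_nonunits_def)
  have "(c [^] m) divides ((a [^] n) [^] m)"
    using car n by (intro divides_pow) auto
  then have "d divides (a [^] (n * m))"
    using d(4) car dcar by (metis divides_trans nat_pow_pow)
  moreover have "n * m \<ge> 1" using n d by simp
  ultimately show "U \<in> GD_basic R a" using d(1,2) unfolding GD_basic_def by blast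
qed

lemma pideal_class_in_GD_basic_self:
  assumes "a \<in> nonzero_nonunits R"
  shows "pideal_class R a \<in> GD_basic R a"
proof -
  have "a \<in> carrier R" using assms by (auto simp: nonzero_nonunits_def)
  then have "a divides (a [^] (1::nat))" by (auto simp: factor_def intro!: bexI[of _ \<one>])
  then show ?thesis using assms unfolding GD_basic_def by blast
qed

lemma istopology_GD:
  "istopology (arbitrary union_of (\<lambda>U. \<exists>a \<in> nonzero_nonunits R. U = GD_basic R a))"
  unfolding istopology_base_eq
proof (intro allI impI)
  let ?P = "\<lambda>U. \<exists>a \<in> nonzero_nonunits R. U = GD_basic R a"
  fix S T assume "?P S \<and> ?P T"
  then obtain a b where ab: "a \<in> nonzero_nonunits R" "S = GD_basic R a"
    "b \<in> nonzero_nonunits R" "T = GD_basic R b" by auto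
  have "\<exists>V. ?P V \<and> x \<in> V \<and> V \<subseteq> S \<inter> T" if x: "x \<in> S \<inter> T" for x
  proof -
    obtain c where c: "x = pideal_class R c" "c \<in> nonzero_nonunits R"
      using x ab by (auto simp: GD_basic_def)
    have "GD_basic R c \<subseteq> S \<inter> T" using GD_basic_mono x ab c by blast
    with c pideal_class_in_GD_basic_self show ?thesis by blast
  qed
  then show "(arbitrary union_of ?P) (S \<inter> T)"
    unfolding arbitrary_union_of_alt by blast
qed

lemma openin_GD:
  "openin (GD R) = arbitrary union_of (\<lambda>U. \<exists>a \<in> nonzero_nonunits R. U = GD_basic R a)"
  unfolding GD_def by (rule topology_inverse'[OF istopology_GD])

lemma topspace_GD: "topspace (GD R) = EC R"
proof
  show "topspace (GD R) \<subseteq> EC R"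
  proof
    fix x assume "x \<in> topspace (GD R)"
    then have "\<exists>U. (\<exists>a \<in> nonzero_nonunits R. U = GD_basic R a) \<and> x \<in> U"
      using openin_topspace[of "GD R"] unfolding openin_GD arbitrary_union_of_alt by blast
    then show "x \<in> EC R" by (auto simp: GD_basic_def EC_eq)
  qed
  show "EC R \<subseteq> topspace (GD R)"
  proof
    fix x assume "x \<in> EC R"
    then obtain b where b: "x = pideal_class R b" "b \<in> nonzero_nonunits R"
      by (auto simp: EC_eq)
    have "openin (GD R) (GD_basic R b)"
      unfolding openin_GD by (rule arbitrary_union_of_inc) (use b in blast)
    then show "x \<in> topspace (GD R)"
      using openin_subset pideal_class_in_GD_basic_self b by blast
  qed
qed

end

end

theory Submission
  imports Defs
begin

text \<open>
  The condition \<open>b | a\<^sup>n\<close> for some \<open>n \<ge> 1\<close> says that \<open>a\<close> lies in the radical of \<open>bR\<close>, which is to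
  say that the radical of \<open>aR\<close> is contained in that of \<open>bR\<close> (\<open>radical_PIdl_subset_iff\<close>).  Hence
  the basic set of \<open>a\<close> is the principal up-set generated by \<open>[a]\<close> when classes are compared by
  the radicals of the ideals that they generate, and the open sets of \<open>GD(R)\<close> are exactly the
  up-sets of this quasi-order: the topology is the Alexandrov topology.  Noetherianity is
  therefore the ascending chain condition on up-sets, one of the classical characterizations of a
  well-quasi-order.

  In one direction, a sequence of radicals gives the ascending chain of the up-sets generated by
  its initial segments; once the chain stops, the next term lies above an earlier one.  In the
  other, picking a new point at each strict step of a chain of up-sets gives a sequence in which
  no term lies above an earlier one, because the earlier one would have brought it into the chain
  too soon.
\<close>

context cring
begin

lemma nonzero_nonunits_closed: "a \<in> nonzero_nonunits R \<Longrightarrow> a \<in> carrier R"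
  by (simp add: nonzero_nonunits_def)

text \<open>
  From left to right, test the inclusion on \<open>a\<close> itself.  From right to left, if \<open>a\<close> divides
  \<open>x\<^sup>k\<close> then \<open>b\<close>, dividing \<open>a\<^sup>n\<close>, divides \<open>x\<^sup>k\<^sup>n\<close>.
\<close>

lemma radical_PIdl_subset_iff:
  assumes a: "a \<in> carrier R" and b: "b \<in> carrier R"
  shows "radical R (PIdl a) \<subseteq> radical R (PIdl b) \<longleftrightarrow> (\<exists>n::nat. n \<ge> 1 \<and> b divides (a [^] n))"
proof
  assume sub: "radical R (PIdl a) \<subseteq> radical R (PIdl b)"
  have "a [^] (1::nat) \<in> PIdl a"
    using a cgenideal_self by simp
  then have "a \<in> radical R (PIdl a)"
    unfolding radical_def using a by blast
  then have "a \<in> radical R (PIdl b)"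
    using sub by blast
  then show "\<exists>n::nat. n \<ge> 1 \<and> b divides (a [^] n)"
    unfolding radical_def using a b divides_iff_PIdl_subset by auto
next
  assume "\<exists>n::nat. n \<ge> 1 \<and> b divides (a [^] n)"
  then obtain n :: nat where n: "n \<ge> 1" "b divides (a [^] n)" by blast
  show "radical R (PIdl a) \<subseteq> radical R (PIdl b)"
  proof
    fix x assume "x \<in> radical R (PIdl a)"
    then obtain k :: nat where x: "x \<in> carrier R" and k: "k \<ge> 1" "x [^] k \<in> PIdl a"
      unfolding radical_def by blast
    have "a divides (x [^] k)"
      using a x k divides_iff_PIdl_subset by simp
    then have "(a [^] n) divides (x [^] (k * n))"
      using divides_pow[of a "x [^] k" n] a x by (simp add: nat_pow_pow)
    then have "b divides (x [^] (k * n))"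
      using n b divides_trans by blast
    then have "x [^] (k * n) \<in> PIdl b"
      using b x divides_iff_PIdl_subset by simp
    moreover have "k * n \<ge> 1" using k n by simp
    ultimately show "x \<in> radical R (PIdl b)"
      unfolding radical_def using x by blast
  qed
qed

lemma pideal_class_in_GD_basic_iff_radical:
  assumes "a \<in> nonzero_nonunits R" "b \<in> nonzero_nonunits R"
  shows "pideal_class R b \<in> GD_basic R a \<longleftrightarrow> radical R (PIdl a) \<subseteq> radical R (PIdl b)"
  using assms by (simp add: pideal_class_in_GD_basic_iff radical_PIdl_subset_iff
      nonzero_nonunits_closed)

lemma openin_GD_basic: "a \<in> nonzero_nonunits R \<Longrightarrow> openin (GD R) (GD_basic R a)"
  unfolding openin_GD by (rule arbitrary_union_of_inc) blast

text \<open>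
  \<open>GD_basic R a\<close> is the least open neighbourhood of \<open>[a]\<close>, because any basic set that contains
  \<open>[a]\<close> contains \<open>GD_basic R a\<close>.  This is what makes the open sets up-sets.
\<close>

lemma GD_basic_subset_openin:
  assumes U: "openin (GD R) U" and a: "a \<in> nonzero_nonunits R" and aU: "pideal_class R a \<in> U"
  shows "GD_basic R a \<subseteq> U"
proof -
  obtain c where "c \<in> nonzero_nonunits R" "pideal_class R a \<in> GD_basic R c" "GD_basic R c \<subseteq> U"
    using U aU unfolding openin_GD arbitrary_union_of_alt by blast
  then show ?thesis
    using GD_basic_mono a by blast
qed

lemma noetherian_imp_well_quasi_ordered:
  assumes noeth: "noetherian_space (GD R)"
  shows "well_quasi_ordered_on (principal_radicals R) (\<subseteq>)"
proof -
  have "\<exists>i j. i < j \<and> q i \<subseteq> q j" if q: "\<And>i. q i \<in> principal_radicals R" for q :: "nat \<Rightarrow> 'a set"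
  proof -
    have "\<forall>i. \<exists>a. a \<in> nonzero_nonunits R \<and> q i = radical R (PIdl a)"
      using q unfolding principal_radicals_def by blast
    then obtain a where a: "\<And>i. a i \<in> nonzero_nonunits R" "\<And>i. q i = radical R (PIdl (a i))"
      by metis
    define U where "U n = (\<Union>i\<le>n. GD_basic R (a i))" for n :: nat
    have "openin (GD R) (U n)" for n
      unfolding U_def using a(1) openin_GD_basic by blast
    moreover have "U n \<subseteq> U (Suc n)" for n
      unfolding U_def by (rule UN_mono) auto
    ultimately obtain m where m: "\<forall>n\<ge>m. U n = U m"
      using noeth unfolding noetherian_space_def by blast
    have "pideal_class R (a (Suc m)) \<in> U (Suc m)"
      unfolding U_def using a(1) pideal_class_in_GD_basic_self by blast
    then have "pideal_class R (a (Suc m)) \<in> U m"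
      using m le_SucI by blast
    then obtain i where "i \<le> m" "pideal_class R (a (Suc m)) \<in> GD_basic R (a i)"
      unfolding U_def by blast
    then have "i < Suc m" "q i \<subseteq> q (Suc m)"
      using a pideal_class_in_GD_basic_iff_radical by auto
    then show ?thesis by blast
  qed
  moreover have "reflp_on (principal_radicals R) (\<subseteq>)"
    by (rule reflp_onI) blast
  moreover have "transp_on (principal_radicals R) (\<subseteq>)"
    by (rule transp_onI) blast
  ultimately show ?thesis
    unfolding well_quasi_ordered_on_def by blast
qed

lemma well_quasi_ordered_imp_noetherian:
  assumes wqo: "well_quasi_ordered_on (principal_radicals R) (\<subseteq>)"
  shows "noetherian_space (GD R)"
  unfolding noetherian_space_def
proof (intro allI impI, rule ccontr)
  fix U :: "nat \<Rightarrow> 'a set set"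
  assume U: "(\<forall>n. openin (GD R) (U n)) \<and> (\<forall>n. U n \<subseteq> U (Suc n))"
    and unstable: "\<not> (\<exists>m. \<forall>n\<ge>m. U n = U m)"
  have mono: "U m \<subseteq> U n" if "m \<le> n" for m n
    using lift_Suc_mono_le[of U] U that by blast
  (* A strict step starts at every index, so iterating the choice of its end point from 0
     selects a subsequence of the chain in which every inclusion is strict. *)
  have "\<forall>m. \<exists>n b. m \<le> n \<and> b \<in> nonzero_nonunits R \<and> pideal_class R b \<in> U n - U m"
  proof
    fix m
    obtain n where n: "m \<le> n" "U n \<noteq> U m"
      using unstable by blast
    then obtain x where x: "x \<in> U n - U m"
      using mono by blast
    then have "x \<in> EC R"
      using U openin_subset topspace_GD by blast
    then show "\<exists>n b. m \<le> n \<and> b \<in> nonzero_nonunits R \<and> pideal_class R b \<in> U n - U m"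
      using n x by (auto simp: EC_eq)
  qed
  then obtain g b where g: "\<And>m. m \<le> g m" and b: "\<And>m. b m \<in> nonzero_nonunits R"
    and new: "\<And>m. pideal_class R (b m) \<in> U (g m) - U m"
    by metis
  define f where "f k = (g ^^ k) 0" for k
  have f_Suc: "f (Suc k) = g (f k)" for k
    by (simp add: f_def)
  have f_mono: "f i \<le> f j" if "i \<le> j" for i j
    using lift_Suc_mono_le[of f] g f_Suc that by metis
  have "\<forall>k. radical R (PIdl (b (f k))) \<in> principal_radicals R"
    using b unfolding principal_radicals_def by blast
  then obtain i j where ij: "i < j"
    "radical R (PIdl (b (f i))) \<subseteq> radical R (PIdl (b (f j)))"
    using wqo[unfolded well_quasi_ordered_on_def, THEN conjunct2, THEN conjunct2, THEN spec,
        of "\<lambda>k. radical R (PIdl (b (f k)))"] by blast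
  have "pideal_class R (b (f j)) \<in> GD_basic R (b (f i))"
    using ij(2) b pideal_class_in_GD_basic_iff_radical by blast
  also have "GD_basic R (b (f i)) \<subseteq> U (f (Suc i))"
    using GD_basic_subset_openin U b new f_Suc by (metis DiffD1)
  also have "U (f (Suc i)) \<subseteq> U (f j)"
    using mono f_mono ij(1) by (simp add: Suc_leI)
  finally show False
    using new by blast
qed

end

theorem corollary4p9:
  fixes R :: "('a, 'b) ring_scheme"
  assumes "cring R" and "\<one>\<^bsub>R\<^esub> \<noteq> \<zero>\<^bsub>R\<^esub>"
  shows "noetherian_space (GD R) \<longleftrightarrow> well_quasi_ordered_on (principal_radicals R) (\<subseteq>)"
  using cring.noetherian_imp_well_quasi_ordered[OF assms(1)]
    cring.well_quasi_ordered_imp_noetherian[OF assms(1)] by blast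

end
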